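(* Let $S^{3}\subset\mathbb{R}^{4}$ carry its standard sub-Riemannian structure. Then the set of lengths of the closed (non-constant) sub-Riemannian geodesics on $S^{3}$ is exactly $$\{2\pi\sqrt{n}\,;\ n\in\mathbb{N}\},\qquad \mathbb{N}=\{1,2,3,\ldots\}.$$ That is, every closed sub-Riemannian geodesic has length $2\pi\sqrt{n}$ for some $n\in\mathbb{N}$, and for every $n\in\mathbb{N}$ there is a closed sub-Riemannian geodesic on $S^{3}$ of length $2\pi\sqrt{n}$.
   Context: $S^{3}=\{(x_{1},y_{1},x_{2},y_{2})\in\mathbb{R}^{4}:\ x_{1}^{2}+y_{1}^{2}+x_{2}^{2}+y_{2}^{2}=1\}$. On $S^{3}$ consider the tangent vector fields $$E_{1}=-x_{2}\frac{\partial}{\partial x_{1}}+y_{2}\frac{\partial}{\partial y_{1}}+x_{1}\frac{\partial}{\partial x_{2}}-y_{1}\frac{\partial}{\partial y_{2}},\qquad E_{2}=-y_{2}\frac{\partial}{\partial x_{1}}-x_{2}\frac{\partial}{\partial y_{1}}+y_{1}\frac{\partial}{\partial x_{2}}+x_{1}\frac{\partial}{\partial y_{2}},$$ which are orthonormal for the round metric (the metric induced from $\mathbb{R}^{4}$). The standard sub-Riemannian structure on $S^{3}$ is the horizontal subbundle $\mathcal{H}=\mathrm{Span}\{E_{1},E_{2}\}\subset TS^{3}$, equipped with the Riemannian metric on $\mathcal{H}$ for which $E_{1},E_{2}$ are orthonormal (equivalently, the restriction of the round metric to $\mathcal{H}$). A horizontal curve is a curve whose tangent vectors lie in $\mathcal{H}$;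 its length is the integral of the norm of its velocity with respect to this metric. The sub-Riemannian Hamiltonian is the function on the cotangent bundle $T^{*}S^{3}$ given by $H(q,\xi)=\tfrac12\big(\xi(E_{1}(q))^{2}+\xi(E_{2}(q))^{2}\big)$ for $q\in S^{3}$, $\xi\in T_{q}^{*}S^{3}$. A sub-Riemannian geodesic is the projection $\gamma:\mathbb{R}\to S^{3}$ of a solution of Hamilton's equations for $H$ on $T^{*}S^{3}$ (with its canonical symplectic structure); there are no singular geodesics on $S^{3}$, so these are all the sub-Riemannian geodesics. A sub-Riemannian geodesic $\gamma$ is closed if it is non-constant and there is $T>0$ with $\gamma(t+T)=\gamma(t)$ for all $t\in\mathbb{R}$; its length is the length of $\gamma$ restricted to $[0,T]$ with $T$ the least such positive number. *)

theory Defs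
  imports "HOL-Analysis.Analysis"
begin

text \<open>Coordinates on \<open>\<real>\<^sup>4\<close> are ordered \<open>(x\<^sub>1, y\<^sub>1, x\<^sub>2, y\<^sub>2)\<close>.\<close>

definition S3 :: "(real^4) set" where
  "S3 = {q. (q$1)\<^sup>2 + (q$2)\<^sup>2 + (q$3)\<^sup>2 + (q$4)\<^sup>2 = 1}"

definition E1 :: "real^4 \<Rightarrow> real^4" where
  "E1 q = vector [- (q$3), q$4, q$1, - (q$2)]"

definition E2 :: "real^4 \<Rightarrow> real^4" where
  "E2 q = vector [- (q$4), - (q$3), q$2, q$1]"

definition horizontal_space :: "real^4 \<Rightarrow> (real^4) set" where
  "horizontal_space q = span {E1 q, E2 q}"

text \<open>On a horizontal space the sub-Riemannian metric is the restriction of the Euclidean inner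
  product (\<open>E1_E2_orthonormal\<close> below), so the length of a horizontal curve uses the Euclidean
  norm of its velocity. Geodesics are horizontal by \<open>sr_geodesic_horizontal\<close>.\<close>

definition sr_length :: "(real \<Rightarrow> real^4) \<Rightarrow> real \<Rightarrow> real \<Rightarrow> real" where
  "sr_length \<gamma> a b = integral {a..b} (\<lambda>t. norm (vector_derivative \<gamma> (at t)))"

text \<open>Velocities at \<open>x\<close> of curves in \<open>M\<close>. This is the usual tangent space when \<open>M\<close> is an embedded
  submanifold, which is the only case where it is used.\<close>

definition tangent_space :: "'a::real_normed_vector set \<Rightarrow> 'a \<Rightarrow> 'a set" where
  "tangent_space M x =
     {v. \<exists>c :: real \<Rightarrow> 'a. c 0 = x \<and> (\<forall>s. c s \<in> M) \<and> (c has_vector_derivative v) (at 0)}"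

text \<open>A covector at \<open>q\<close>, that is, a linear functional on the tangent space \<open>q\<^sup>\<bottom>\<close> of the sphere, is
  represented by its unique linear extension to \<open>\<real>\<^sup>4\<close> that vanishes on the normal line \<open>\<real>q\<close>.
  This realises \<open>T\<^sup>*S\<^sup>3\<close> as a 6-dimensional submanifold of \<open>T\<^sup>*\<real>\<^sup>4 = \<real>\<^sup>4 \<times> (\<real>\<^sup>4)\<^sup>*\<close>.\<close>

type_synonym phase = "(real^4) \<times> ((real^4) \<Rightarrow>\<^sub>L real)"

definition cotangent_S3 :: "phase set" where
  "cotangent_S3 = {(q, \<xi>). q \<in> S3 \<and> blinfun_apply \<xi> q = 0}"

text \<open>The tautological one-form \<open>\<theta>\<close> maps a tangent vector at \<open>(q, \<xi>)\<close> to \<open>\<xi>\<close> applied to its base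
  component, and the canonical symplectic form is \<open>\<omega> = - d\<theta>\<close>, where
  \<open>d\<theta>(X, Y) = X(\<theta>(Y)) - Y(\<theta>(X))\<close> for constant \<open>X\<close>, \<open>Y\<close>. The formulas make sense on all of
  \<open>T\<^sup>*\<real>\<^sup>4\<close>; since \<open>d\<close> commutes with pullback, the forms on \<open>T\<^sup>*S\<^sup>3\<close> are obtained by inserting only
  vectors tangent to \<open>cotangent_S3\<close>. The same applies to the differential of the Hamiltonian.\<close>

definition tautological_form :: "phase \<Rightarrow> phase \<Rightarrow> real" where
  "tautological_form z X = blinfun_apply (snd z) (fst X)"

definition symplectic_form :: "phase \<Rightarrow> phase \<Rightarrow> phase \<Rightarrow> real" where
  "symplectic_form z X Y =
     - (frechet_derivative (\<lambda>w. tautological_form w Y) (at z) X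
        - frechet_derivative (\<lambda>w. tautological_form w X) (at z) Y)"

definition hamiltonian :: "phase \<Rightarrow> real" where
  "hamiltonian z =
     (1/2) * ((blinfun_apply (snd z) (E1 (fst z)))\<^sup>2 + (blinfun_apply (snd z) (E2 (fst z)))\<^sup>2)"

definition hamilton_solution :: "(real \<Rightarrow> phase) \<Rightarrow> bool" where
  "hamilton_solution z \<longleftrightarrow>
     (\<forall>t. z t \<in> cotangent_S3) \<and>
     (\<forall>t. \<exists>Z. (z has_vector_derivative Z) (at t) \<and>
        (\<forall>Y \<in> tangent_space cotangent_S3 (z t).
           symplectic_form (z t) Z Y = frechet_derivative hamiltonian (at (z t)) Y))"

definition sr_geodesic :: "(real \<Rightarrow> real^4) \<Rightarrow> bool" where
  "sr_geodesic \<gamma> \<longleftrightarrow> (\<exists>z. hamilton_solution z \<and> \<gamma> = fst \<circ> z)"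

definition closed_sr_geodesic :: "(real \<Rightarrow> real^4) \<Rightarrow> bool" where
  "closed_sr_geodesic \<gamma> \<longleftrightarrow>
     sr_geodesic \<gamma> \<and> \<not> \<gamma> constant_on UNIV \<and> (\<exists>T>0. \<forall>t. \<gamma> (t + T) = \<gamma> t)"

definition closed_geodesic_length :: "(real \<Rightarrow> real^4) \<Rightarrow> real" where
  "closed_geodesic_length \<gamma> = sr_length \<gamma> 0 (LEAST T. 0 < T \<and> (\<forall>t. \<gamma> (t + T) = \<gamma> t))"

lemma E1_E2_nth [simp]:
  "E1 q $ 1 = - (q$3)" "E1 q $ 2 = q$4" "E1 q $ 3 = q$1" "E1 q $ 4 = - (q$2)"
  "E2 q $ 1 = - (q$4)" "E2 q $ 2 = - (q$3)" "E2 q $ 3 = q$2" "E2 q $ 4 = q$1"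
  by (simp_all add: E1_def E2_def vector_def)

lemma E1_E2_orthonormal:
  assumes "q \<in> S3"
  shows "E1 q \<bullet> q = 0" "E2 q \<bullet> q = 0" "E1 q \<bullet> E2 q = 0" "E1 q \<bullet> E1 q = 1" "E2 q \<bullet> E2 q = 1"
  using assms by (simp_all add: S3_def inner_vec_def sum_4 power2_eq_square)

lemma bounded_linear_E1: "bounded_linear E1"
  by (intro linear_conv_bounded_linear[THEN iffD1] linearI)
     (simp_all add: vec_eq_iff forall_4)

lemma bounded_linear_E2: "bounded_linear E2"
  by (intro linear_conv_bounded_linear[THEN iffD1] linearI)
     (simp_all add: vec_eq_iff forall_4)

lemma symplectic_form_eq:
  "symplectic_form z (u, \<alpha>) (v, \<beta>) = blinfun_apply \<beta> u - blinfun_apply \<alpha> v"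
proof -
  have "((\<lambda>w. tautological_form w X) has_derivative (\<lambda>W. blinfun_apply (snd W) (fst X))) (at z)"
    for X
    unfolding tautological_form_def
    by (intro bounded_linear_imp_has_derivative bounded_linear_compose[OF
          blinfun.bounded_linear_left bounded_linear_snd])
  note frechet_derivative_at[OF this, symmetric]
  then show ?thesis
    by (simp add: symplectic_form_def)
qed

lemma hamiltonian_derivative:
  "frechet_derivative hamiltonian (at (q, \<xi>)) (v, \<beta>) =
     blinfun_apply \<xi> (E1 q) * (blinfun_apply \<beta> (E1 q) + blinfun_apply \<xi> (E1 v)) +
     blinfun_apply \<xi> (E2 q) * (blinfun_apply \<beta> (E2 q) + blinfun_apply \<xi> (E2 v))"
proof -
  have d: "((\<lambda>z :: phase. blinfun_apply (snd z) (f (fst z))) has_derivative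
      (\<lambda>W. blinfun_apply \<xi> (f (fst W)) + blinfun_apply (snd W) (f q))) (at (q, \<xi>))"
    if f: "bounded_linear f" for f :: "real^4 \<Rightarrow> real^4"
  proof -
    have "((\<lambda>z :: phase. f (fst z)) has_derivative (\<lambda>W. f (fst W))) (at (q, \<xi>))"
      by (intro bounded_linear_imp_has_derivative bounded_linear_compose[OF f] bounded_linear_fst)
    from bounded_bilinear.FDERIV[OF bounded_bilinear_blinfun_apply
        bounded_linear_imp_has_derivative[OF bounded_linear_snd] this]
    show ?thesis by simp
  qed
  let ?D = "\<lambda>W :: phase.
     blinfun_apply \<xi> (E1 q) * (blinfun_apply (snd W) (E1 q) + blinfun_apply \<xi> (E1 (fst W))) +
     blinfun_apply \<xi> (E2 q) * (blinfun_apply (snd W) (E2 q) + blinfun_apply \<xi> (E2 (fst W)))"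
  have "(hamiltonian has_derivative ?D) (at (q, \<xi>))"
    unfolding hamiltonian_def[abs_def] power2_eq_square
    by (rule has_derivative_eq_rhs[OF has_derivative_mult_right[OF has_derivative_add[OF
            has_derivative_mult[OF d d] has_derivative_mult[OF d d]]]])
       (use bounded_linear_E1 bounded_linear_E2 in \<open>simp_all add: fun_eq_iff algebra_simps\<close>)
  from fun_cong[OF frechet_derivative_at[OF this], of "(v, \<beta>)"] show ?thesis
    by simp
qed

lemma sr_geodesic_horizontal:
  assumes "sr_geodesic \<gamma>"
  shows "\<gamma> differentiable (at t)" "\<gamma> t \<in> S3"
    "vector_derivative \<gamma> (at t) \<in> horizontal_space (\<gamma> t)"
proof -
  obtain z where z: "hamilton_solution z" and \<gamma>: "\<gamma> = fst \<circ> z"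
    using assms by (auto simp: sr_geodesic_def)
  obtain q \<xi> where zt: "z t = (q, \<xi>)" by fastforce
  have q: "q \<in> S3" "blinfun_apply \<xi> q = 0" and S: "\<gamma> s \<in> S3" for s
  proof -
    have c: "z s \<in> cotangent_S3" for s using z by (simp add: hamilton_solution_def)
    show "q \<in> S3" "blinfun_apply \<xi> q = 0" using c[of t] zt by (auto simp: cotangent_S3_def)
    show "\<gamma> s \<in> S3" using c[of s] \<gamma> by (auto simp: cotangent_S3_def)
  qed
  obtain u \<alpha> where Z: "(z has_vector_derivative (u, \<alpha>)) (at t)"
    and H: "\<And>Y. Y \<in> tangent_space cotangent_S3 (q, \<xi>) \<Longrightarrow>
      symplectic_form (q, \<xi>) (u, \<alpha>) Y = frechet_derivative hamiltonian (at (q, \<xi>)) Y"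
    using z zt unfolding hamilton_solution_def by (metis surj_pair)
  have d: "(\<gamma> has_vector_derivative u) (at t)"
    using bounded_linear.has_vector_derivative[OF bounded_linear_fst Z] \<gamma> by (simp add: o_def)
  have 0: "q \<bullet> u = 0"
  proof -
    have "\<gamma> s \<bullet> \<gamma> s = 1" for s
      using S[of s] by (simp add: S3_def inner_vec_def sum_4 power2_eq_square)
    moreover have "((\<lambda>s. \<gamma> s \<bullet> \<gamma> s) has_vector_derivative \<gamma> t \<bullet> u + u \<bullet> \<gamma> t) (at t)"
      by (rule bounded_bilinear.has_vector_derivative[OF bounded_bilinear_inner d d])
    ultimately have "((\<lambda>s. 1::real) has_vector_derivative \<gamma> t \<bullet> u + u \<bullet> \<gamma> t) (at t)" by simp
    then have "\<gamma> t \<bullet> u + u \<bullet> \<gamma> t = 0"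
      by (rule vector_derivative_unique_at[OF _ has_vector_derivative_const])
    then show ?thesis using \<gamma> zt by (simp add: inner_commute)
  qed
  define a b where "a = blinfun_apply \<xi> (E1 q)" and "b = blinfun_apply \<xi> (E2 q)"
  define w where "w = u - a *\<^sub>R E1 q - b *\<^sub>R E2 q"
  have wq: "w \<bullet> q = 0"
    using 0 E1_E2_orthonormal[OF q(1)] inner_commute[of u q] by (simp add: w_def inner_diff_left)
  define \<beta> where "\<beta> = blinfun_inner_left w"
  have \<beta>: "blinfun_apply \<beta> x = x \<bullet> w" for x by (simp add: \<beta>_def inner_commute)
  have "(0, \<beta>) \<in> tangent_space cotangent_S3 (q, \<xi>)"
    unfolding tangent_space_def
  proof (rule CollectI, intro exI conjI allI)
    show "((\<lambda>s. (q, \<xi> + s *\<^sub>R \<beta>)) has_vector_derivative (0, \<beta>)) (at 0)"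
      unfolding has_vector_derivative_def by (auto intro!: derivative_eq_intros)
    show "(q, \<xi> + s *\<^sub>R \<beta>) \<in> cotangent_S3" for s
      using q wq by (simp add: cotangent_S3_def blinfun.bilinear_simps \<beta> inner_commute)
  qed simp
  from H[OF this] have "u \<bullet> w = a * (E1 q \<bullet> w) + b * (E2 q \<bullet> w)"
    using bounded_linear.linear[OF bounded_linear_E1] bounded_linear.linear[OF bounded_linear_E2]
    by (simp add: symplectic_form_eq hamiltonian_derivative \<beta> a_def b_def linear_0)
  moreover have "w \<bullet> w = u \<bullet> w - a * (E1 q \<bullet> w) - b * (E2 q \<bullet> w)"
    unfolding w_def[THEN arg_cong[of _ _ "\<lambda>x. x \<bullet> w"]] by (simp add: inner_diff_left)
  ultimately have "w \<bullet> w = 0" by simp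
  then have "w = 0" by simp
  then have u: "u = a *\<^sub>R E1 q + b *\<^sub>R E2 q" unfolding w_def by (simp only: diff_diff_eq right_minus_eq)
  have "u \<in> horizontal_space q"
    unfolding u horizontal_space_def by (intro span_add span_scale span_base) auto
  then show "vector_derivative \<gamma> (at t) \<in> horizontal_space (\<gamma> t)"
    using d \<gamma> zt by (simp add: vector_derivative_at)
  show "\<gamma> differentiable (at t)" "\<gamma> t \<in> S3"
    using d S by (auto intro: differentiableI_vector)
qed

end

theory Submission
  imports Defs
begin

text \<open>Identify \<open>\<real>\<^sup>4\<close> with \<open>\<complex>\<^sup>2\<close>. Then \<open>E1\<close>, \<open>E2\<close> and multiplication by \<open>i\<close> (\<open>E3\<close> below) satisfy the
  quaternion relations. With \<open>a, b, c\<close> the values of the covector on these three fields, Hamilton's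
  equations become \<open>\<gamma>' = a E1 \<gamma> + b E2 \<gamma>\<close>, \<open>a' = 2 c b\<close>, \<open>b' = - 2 c a\<close>, \<open>c' = 0\<close>. Hence the speed
  \<open>r = (a\<^sup>2 + b\<^sup>2)\<^bsup>1/2\<^esup>\<close> is constant and \<open>\<gamma>'' + 2 c i \<gamma>' + r\<^sup>2 \<gamma> = 0\<close>, whose characteristic exponents
  are \<open>i \<alpha>\<close> and \<open>- i \<beta>\<close> with \<open>\<alpha>, \<beta> > 0\<close>, \<open>\<alpha> \<beta> = r\<^sup>2\<close> and \<open>\<alpha> - \<beta> = - 2 c\<close>. Both modes \<open>\<gamma>' + \<beta> i \<gamma>\<close> and
  \<open>\<gamma>' - \<alpha> i \<gamma>\<close> are nonzero, so a period \<open>T\<close> satisfies \<open>\<alpha> T = 2 \<pi> k\<close> and \<open>\<beta> T = 2 \<pi> l\<close> with positive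
  integers \<open>k, l\<close>, and \<open>(r T)\<^sup>2 = (2 \<pi>)\<^sup>2 k l\<close>. The choice \<open>k = n\<close>, \<open>l = 1\<close> realises every \<open>n\<close>.\<close>

section \<open>Quaternionic algebra of the three frame fields\<close>

definition E3 :: "real^4 \<Rightarrow> real^4" where
  "E3 q = vector [- (q$2), q$1, - (q$4), q$3]"

lemma E3_nth [simp]:
  "E3 q $ 1 = - (q$2)" "E3 q $ 2 = q$1" "E3 q $ 3 = - (q$4)" "E3 q $ 4 = q$3"
  by (simp_all add: E3_def vector_def)

lemma bounded_linear_E3: "bounded_linear E3"
  by (intro linear_conv_bounded_linear[THEN iffD1] linearI)
     (simp_all add: vec_eq_iff forall_4)

lemma quaternion_relations:
  "E1 (E1 q) = - q" "E2 (E2 q) = - q" "E3 (E3 q) = - q"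
  "E1 (E2 q) = E3 q" "E2 (E1 q) = - E3 q"
  "E2 (E3 q) = E1 q" "E3 (E2 q) = - E1 q"
  "E3 (E1 q) = E2 q" "E1 (E3 q) = - E2 q"
  by (simp_all add: vec_eq_iff forall_4)

lemma E_skew:
  "E1 x \<bullet> y = - (x \<bullet> E1 y)" "E2 x \<bullet> y = - (x \<bullet> E2 y)" "E3 x \<bullet> y = - (x \<bullet> E3 y)"
  by (simp_all add: inner_vec_def sum_4)

lemma E_perp [simp]:
  "x \<bullet> E1 x = 0" "x \<bullet> E2 x = 0" "x \<bullet> E3 x = 0"
  "E1 x \<bullet> x = 0" "E2 x \<bullet> x = 0" "E3 x \<bullet> x = 0"
  by (simp_all add: inner_vec_def sum_4)

lemma E_perp_E [simp]:
  "E1 x \<bullet> E2 x = 0" "E1 x \<bullet> E3 x = 0" "E2 x \<bullet> E3 x = 0"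
  "E2 x \<bullet> E1 x = 0" "E3 x \<bullet> E1 x = 0" "E3 x \<bullet> E2 x = 0"
  by (simp_all add: inner_vec_def sum_4)

lemma E_inner_E [simp]:
  "E1 x \<bullet> E1 y = x \<bullet> y" "E2 x \<bullet> E2 y = x \<bullet> y" "E3 x \<bullet> E3 y = x \<bullet> y"
  by (simp_all add: inner_vec_def sum_4)

lemmas E_linear =
  bounded_linear_E1[THEN bounded_linear.linear] bounded_linear_E2[THEN bounded_linear.linear]
  bounded_linear_E3[THEN bounded_linear.linear]

lemmas E_linear_simps =
  E_linear[THEN linear_add] E_linear[THEN linear_diff] E_linear[THEN linear_scale]
  E_linear[THEN linear_neg] E_linear[THEN linear_0]

lemmas E_has_vector_derivative =
  bounded_linear_E1[THEN bounded_linear.has_vector_derivative]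
  bounded_linear_E2[THEN bounded_linear.has_vector_derivative]
  bounded_linear_E3[THEN bounded_linear.has_vector_derivative]

lemma S3_iff_inner: "q \<in> S3 \<longleftrightarrow> q \<bullet> q = 1"
  by (simp add: S3_def inner_vec_def sum_4 power2_eq_square)

lemma inner_frame:
  assumes "q \<bullet> q = 1"
  shows "(a *\<^sub>R E1 q + b *\<^sub>R E2 q) \<bullet> (a *\<^sub>R E1 q + b *\<^sub>R E2 q) = a\<^sup>2 + b\<^sup>2"
  using assms by (simp add: inner_add power2_eq_square)

section \<open>Two facts on derivatives of curves\<close>

lemma has_vector_derivative_vec:
  fixes f :: "real \<Rightarrow> real^'n"
  assumes "\<And>i. ((\<lambda>t. f t $ i) has_real_derivative d $ i) (at t)"
  shows "(f has_vector_derivative d) (at t)"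
  unfolding has_vector_derivative_def has_derivative_componentwise_within[of f]
  using assms
  by (auto simp: Basis_vec_def inner_axis has_field_derivative_def mult.commute[of _ "d $ _"])

lemma constant_if_vector_derivative_zero:
  fixes f :: "real \<Rightarrow> 'a::real_normed_vector"
  assumes "\<And>t. (f has_vector_derivative 0) (at t)"
  shows "f t = f 0"
proof -
  obtain c where "\<And>x. x \<in> UNIV \<Longrightarrow> f x = c"
    using has_vector_derivative_zero_constant[of UNIV f] assms by auto
  then show ?thesis by auto
qed

section \<open>Hamilton's equations on the cotangent bundle, rewritten in the frame\<close>

text \<open>The tangent vectors to the cotangent lift of the flow \<open>cos s + sin s F\<close>; testing Hamilton's equations
  on them gives the derivative of the momentum \<open>\<xi> (F q)\<close>.\<close>

lemma rotation_tangent: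
  assumes F: "bounded_linear F" and FF: "\<And>x. F (F x) = - x"
    and perp: "q \<bullet> F q = 0" and iso: "F q \<bullet> F q = q \<bullet> q"
    and z: "(q, \<xi>) \<in> cotangent_S3"
  shows "(F q, - (\<xi> o\<^sub>L Blinfun F)) \<in> tangent_space cotangent_S3 (q, \<xi>)"
proof -
  define \<eta> where "\<eta> = \<xi> o\<^sub>L Blinfun F"
  have \<eta>: "blinfun_apply \<eta> x = blinfun_apply \<xi> (F x)" for x
    by (simp add: \<eta>_def bounded_linear_Blinfun_apply[OF F])
  have q: "q \<bullet> q = 1" "blinfun_apply \<xi> q = 0"
    using z by (auto simp: cotangent_S3_def S3_iff_inner)
  \<comment> \<open>Since \<open>F\<close> squares to -1, the inverse of
    \<open>cos s + sin s F\<close> is \<open>cos s - sin s F\<close>. The covector is composed with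
    this inverse, so its value on the moving base point stays \<open>\<xi> q = 0\<close>.\<close>
  let ?c = "\<lambda>s. (cos s *\<^sub>R q + sin s *\<^sub>R F q, cos s *\<^sub>R \<xi> - sin s *\<^sub>R \<eta>)"
  have "((\<lambda>s. cos s *\<^sub>R q + sin s *\<^sub>R F q) has_vector_derivative F q) (at 0)"
    by (auto intro!: derivative_eq_intros simp: has_real_derivative_iff_has_vector_derivative[symmetric])
  moreover have "((\<lambda>s. cos s *\<^sub>R \<xi> - sin s *\<^sub>R \<eta>) has_vector_derivative - \<eta>) (at 0)"
    by (auto intro!: derivative_eq_intros simp: has_real_derivative_iff_has_vector_derivative[symmetric])
  ultimately have "(?c has_vector_derivative (F q, - \<eta>)) (at 0)"
    by (rule has_vector_derivative_Pair)
  moreover have "?c s \<in> cotangent_S3" for s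
  proof -
    have "(cos s *\<^sub>R q + sin s *\<^sub>R F q) \<bullet> (cos s *\<^sub>R q + sin s *\<^sub>R F q) = (cos s)\<^sup>2 + (sin s)\<^sup>2"
      using perp iso q(1) by (simp add: inner_add inner_commute power2_eq_square)
    moreover have "blinfun_apply (cos s *\<^sub>R \<xi> - sin s *\<^sub>R \<eta>) (cos s *\<^sub>R q + sin s *\<^sub>R F q) = 0"
      using q(2) by (simp add: blinfun.bilinear_simps \<eta> FF)
    ultimately show ?thesis
      by (simp add: cotangent_S3_def S3_iff_inner)
  qed
  moreover have "?c 0 = (q, \<xi>)" by simp
  ultimately show ?thesis
    unfolding tangent_space_def \<eta>_def[symmetric] by (intro CollectI exI[of _ ?c] conjI allI)
qed

text \<open>Fibre directions; testing Hamilton's equations on them recovers the velocity of the base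
  point.\<close>

lemma vertical_tangent:
  assumes "(q, \<xi>) \<in> cotangent_S3" "blinfun_apply \<beta> q = 0"
  shows "(0, \<beta>) \<in> tangent_space cotangent_S3 (q, \<xi>)"
  unfolding tangent_space_def
proof (rule CollectI, intro exI conjI allI)
  show "((\<lambda>s. (q, \<xi> + s *\<^sub>R \<beta>)) has_vector_derivative (0, \<beta>)) (at 0)"
    unfolding has_vector_derivative_def by (auto intro!: derivative_eq_intros)
  show "(q, \<xi> + s *\<^sub>R \<beta>) \<in> cotangent_S3" for s
    using assms by (simp add: cotangent_S3_def blinfun.bilinear_simps)
qed simp

text \<open>Vertical vectors test the velocity only against covectors that vanish on
  \<open>q\<close>. This determines it up to a multiple of \<open>q\<close>, and
  \<open>u \<bullet> q = 0\<close> removes that ambiguity. The covector dual to the difference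
  \<open>w\<close> of the two sides yields \<open>w \<bullet> w = 0\<close>.\<close>

lemma hamilton_solution_base_derivative:
  assumes z: "(q, \<xi>) \<in> cotangent_S3" and u: "u \<bullet> q = 0"
    and H: "\<And>Y. Y \<in> tangent_space cotangent_S3 (q, \<xi>) \<Longrightarrow>
      symplectic_form (q, \<xi>) (u, \<alpha>) Y = frechet_derivative hamiltonian (at (q, \<xi>)) Y"
  shows "u = blinfun_apply \<xi> (E1 q) *\<^sub>R E1 q + blinfun_apply \<xi> (E2 q) *\<^sub>R E2 q" (is "u = ?h")
proof -
  define w where "w = u - ?h"
  have w: "w \<bullet> q = 0"
    using u by (simp add: w_def inner_diff_left inner_add_left)
  then have "u \<bullet> w = ?h \<bullet> w"
    using H[OF vertical_tangent[OF z, of "blinfun_inner_left w"]]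
    by (simp add: symplectic_form_eq hamiltonian_derivative E_linear_simps inner_add_left
        inner_commute[of q w])
  then have "w \<bullet> w = 0"
    by (simp add: w_def[THEN arg_cong[of _ _ "\<lambda>x. x \<bullet> w"]] inner_diff_left)
  then show ?thesis by (simp add: w_def)
qed

text \<open>By the product rule the left side is the derivative of the momentum
  \<open>\<xi> (F q)\<close> along a solution with velocity \<open>(u, \<alpha>)\<close>. Testing on
  the rotation vector leaves only the commutators of \<open>F\<close> with \<open>E1\<close> and
  \<open>E2\<close>.\<close>

lemma hamilton_solution_momentum_derivative:
  assumes z: "(q, \<xi>) \<in> cotangent_S3"
    and H: "\<And>Y. Y \<in> tangent_space cotangent_S3 (q, \<xi>) \<Longrightarrow>
      symplectic_form (q, \<xi>) (u, \<alpha>) Y = frechet_derivative hamiltonian (at (q, \<xi>)) Y"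
    and F: "bounded_linear F" "\<And>x. F (F x) = - x" "q \<bullet> F q = 0" "F q \<bullet> F q = q \<bullet> q"
  shows "blinfun_apply \<alpha> (F q) + blinfun_apply \<xi> (F u) =
    blinfun_apply \<xi> (E1 q) * (blinfun_apply \<xi> (F (E1 q)) - blinfun_apply \<xi> (E1 (F q))) +
    blinfun_apply \<xi> (E2 q) * (blinfun_apply \<xi> (F (E2 q)) - blinfun_apply \<xi> (E2 (F q)))"
  using H[OF rotation_tangent[OF F z]]
  by (simp add: symplectic_form_eq hamiltonian_derivative bounded_linear_Blinfun_apply[OF F(1)]
      blinfun.bilinear_simps algebra_simps)

lemma sr_geodesic_frame_equations:
  assumes "sr_geodesic \<gamma>"
  obtains a b :: "real \<Rightarrow> real" and c :: real where
    "\<And>t. \<gamma> t \<bullet> \<gamma> t = 1"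
    "\<And>t. (\<gamma> has_vector_derivative a t *\<^sub>R E1 (\<gamma> t) + b t *\<^sub>R E2 (\<gamma> t)) (at t)"
    "\<And>t. (a has_real_derivative 2 * c * b t) (at t)"
    "\<And>t. (b has_real_derivative - 2 * c * a t) (at t)"
proof -
  obtain z where z: "hamilton_solution z" and \<gamma>: "\<gamma> = fst \<circ> z"
    using assms by (auto simp: sr_geodesic_def)
  define \<xi> where "\<xi> = snd \<circ> z"
  have zt: "z t = (\<gamma> t, \<xi> t)" for t by (simp add: \<gamma> \<xi>_def)
  have cot: "(\<gamma> t, \<xi> t) \<in> cotangent_S3" for t
    using z by (simp add: hamilton_solution_def zt[symmetric])
  then have one: "\<gamma> t \<bullet> \<gamma> t = 1" for t
    by (auto simp: cotangent_S3_def S3_iff_inner)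
  have "\<forall>t. \<exists>u \<alpha>. (z has_vector_derivative (u, \<alpha>)) (at t) \<and>
    (\<forall>Y \<in> tangent_space cotangent_S3 (\<gamma> t, \<xi> t).
      symplectic_form (\<gamma> t, \<xi> t) (u, \<alpha>) Y = frechet_derivative hamiltonian (at (\<gamma> t, \<xi> t)) Y)"
    (is "\<forall>t. ?P t")
  proof
    fix t
    obtain Z where "(z has_vector_derivative Z) (at t)"
      "\<forall>Y \<in> tangent_space cotangent_S3 (\<gamma> t, \<xi> t).
        symplectic_form (\<gamma> t, \<xi> t) Z Y = frechet_derivative hamiltonian (at (\<gamma> t, \<xi> t)) Y"
      using z unfolding hamilton_solution_def zt by blast
    then show "?P t" by (cases Z) blast
  qed
  then obtain u \<alpha> where Z: "\<And>t. (z has_vector_derivative (u t, \<alpha> t)) (at t)"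
    and H: "\<And>t Y. Y \<in> tangent_space cotangent_S3 (\<gamma> t, \<xi> t) \<Longrightarrow>
      symplectic_form (\<gamma> t, \<xi> t) (u t, \<alpha> t) Y = frechet_derivative hamiltonian (at (\<gamma> t, \<xi> t)) Y"
    by metis
  have d\<gamma>: "(\<gamma> has_vector_derivative u t) (at t)" for t
    using bounded_linear.has_vector_derivative[OF bounded_linear_fst Z] by (simp add: \<gamma> o_def)
  have d\<xi>: "(\<xi> has_vector_derivative \<alpha> t) (at t)" for t
    using bounded_linear.has_vector_derivative[OF bounded_linear_snd Z] by (simp add: \<xi>_def o_def)
  have perp: "u t \<bullet> \<gamma> t = 0" for t
  proof -
    have "((\<lambda>s. \<gamma> s \<bullet> \<gamma> s) has_vector_derivative \<gamma> t \<bullet> u t + u t \<bullet> \<gamma> t) (at t)"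
      by (rule bounded_bilinear.has_vector_derivative[OF bounded_bilinear_inner d\<gamma> d\<gamma>])
    then have "\<gamma> t \<bullet> u t + u t \<bullet> \<gamma> t = 0"
      unfolding one by (rule vector_derivative_unique_at[OF _ has_vector_derivative_const])
    then show ?thesis by (simp add: inner_commute)
  qed
  define m where "m F t = blinfun_apply (\<xi> t) (F (\<gamma> t))" for F t
  have dm: "(m F has_real_derivative
      m E1 t * (blinfun_apply (\<xi> t) (F (E1 (\<gamma> t))) - blinfun_apply (\<xi> t) (E1 (F (\<gamma> t)))) +
      m E2 t * (blinfun_apply (\<xi> t) (F (E2 (\<gamma> t))) - blinfun_apply (\<xi> t) (E2 (F (\<gamma> t))))) (at t)"
    if F: "bounded_linear F" "\<And>x. F (F x) = - x" "\<And>x. x \<bullet> F x = 0" "\<And>x. F x \<bullet> F x = x \<bullet> x" for F t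
  proof -
    have "(m F has_vector_derivative
        blinfun_apply (\<xi> t) (F (u t)) + blinfun_apply (\<alpha> t) (F (\<gamma> t))) (at t)"
      unfolding m_def
      by (rule bounded_bilinear.has_vector_derivative[OF bounded_bilinear_blinfun_apply d\<xi>
            bounded_linear.has_vector_derivative[OF F(1) d\<gamma>]])
    with hamilton_solution_momentum_derivative[OF cot H F, of t] show ?thesis
      by (simp add: m_def has_real_derivative_iff_has_vector_derivative add.commute)
  qed
  \<comment> \<open>The commutators of \<open>E3\<close> with \<open>E1\<close> and
    \<open>E2\<close> are \<open>2 E2\<close> and \<open>- 2 E1\<close>, so the two terms of
    \<open>dm\<close> cancel. The conserved value becomes the constant \<open>c\<close>.\<close>
  have "(m E3 has_vector_derivative 0) (at t)" for t
    using dm[OF bounded_linear_E3, of t]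
    by (simp add: quaternion_relations blinfun.bilinear_simps m_def
        has_real_derivative_iff_has_vector_derivative)
  note m3 = constant_if_vector_derivative_zero[OF this]
  show thesis
  proof (rule that)
    show "(\<gamma> has_vector_derivative m E1 t *\<^sub>R E1 (\<gamma> t) + m E2 t *\<^sub>R E2 (\<gamma> t)) (at t)" for t
      using d\<gamma>[of t] hamilton_solution_base_derivative[OF cot perp H, of t] by (simp add: m_def)
    show "(m E1 has_real_derivative 2 * m E3 0 * m E2 t) (at t)" for t
      using dm[OF bounded_linear_E1, of t] m3[of t]
      by (simp add: quaternion_relations blinfun.bilinear_simps m_def mult_ac)
    show "(m E2 has_real_derivative - 2 * m E3 0 * m E1 t) (at t)" for t
      using dm[OF bounded_linear_E2, of t] m3[of t]
      by (simp add: quaternion_relations blinfun.bilinear_simps m_def mult_ac)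
  qed (rule one)
qed

section \<open>Periods and lengths of closed geodesics\<close>

text \<open>The explicit rotation of \<open>f 0\<close> by the angle \<open>\<omega> t\<close>
  solves the same linear equation as \<open>f\<close>. Since \<open>E3\<close> is skew, the inner
  product of two solutions is constant; comparing times \<open>0\<close> and \<open>T\<close>
  isolates the cosine because \<open>E3 (f 0)\<close> is orthogonal to \<open>f 0\<close>.\<close>

lemma rotating_periodic_imp_cos_eq_1:
  assumes f: "\<And>t. (f has_vector_derivative \<omega> *\<^sub>R E3 (f t)) (at t)"
    and T: "f T = f 0" and "f 0 \<noteq> 0"
  shows "cos (\<omega> * T) = 1"
proof -
  let ?v = "f 0"
  let ?g = "\<lambda>t. f t \<bullet> (cos (\<omega> * t) *\<^sub>R ?v + sin (\<omega> * t) *\<^sub>R E3 ?v)"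
  have "(?g has_vector_derivative 0) (at t)" for t
  proof -
    have "((\<lambda>t. cos (\<omega> * t) *\<^sub>R ?v + sin (\<omega> * t) *\<^sub>R E3 ?v) has_vector_derivative
        \<omega> *\<^sub>R E3 (cos (\<omega> * t) *\<^sub>R ?v + sin (\<omega> * t) *\<^sub>R E3 ?v)) (at t)" (is "(?r has_vector_derivative _) _")
      by (auto intro!: derivative_eq_intros
          simp: has_real_derivative_iff_has_vector_derivative[symmetric] E_linear_simps
            quaternion_relations algebra_simps)
    from bounded_bilinear.has_vector_derivative[OF bounded_bilinear_inner f this]
    show ?thesis by (simp add: E_skew)
  qed
  from constant_if_vector_derivative_zero[OF this, of T]
  have "cos (\<omega> * T) * (?v \<bullet> ?v) = ?v \<bullet> ?v"
    by (simp add: T inner_add_right)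
  with \<open>f 0 \<noteq> 0\<close> show ?thesis by simp
qed

lemma closed_sr_geodesic_length_cases:
  assumes "closed_sr_geodesic \<gamma>"
  obtains n :: nat where "n \<ge> 1" "closed_geodesic_length \<gamma> = 2 * pi * sqrt (real n)"
proof -
  have geo: "sr_geodesic \<gamma>" and nonconst: "\<not> \<gamma> constant_on UNIV"
    and closed: "\<exists>T>0. \<forall>t. \<gamma> (t + T) = \<gamma> t"
    using assms by (auto simp: closed_sr_geodesic_def)
  obtain a b c where one: "\<And>t. \<gamma> t \<bullet> \<gamma> t = 1"
    and d\<gamma>: "\<And>t. (\<gamma> has_vector_derivative a t *\<^sub>R E1 (\<gamma> t) + b t *\<^sub>R E2 (\<gamma> t)) (at t)"
    and da: "\<And>t. (a has_real_derivative 2 * c * b t) (at t)"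
    and db: "\<And>t. (b has_real_derivative - 2 * c * a t) (at t)"
    by (rule sr_geodesic_frame_equations[OF geo]) blast
  define u where "u t = a t *\<^sub>R E1 (\<gamma> t) + b t *\<^sub>R E2 (\<gamma> t)" for t
  note d\<gamma>' = d\<gamma>[folded u_def]
  define r where "r = sqrt ((a 0)\<^sup>2 + (b 0)\<^sup>2)"
  have "((\<lambda>t. (a t)\<^sup>2 + (b t)\<^sup>2) has_vector_derivative 0) (at t)" for t
    unfolding has_real_derivative_iff_has_vector_derivative[symmetric]
    by (auto intro!: derivative_eq_intros da db)
  from constant_if_vector_derivative_zero[OF this]
  have r2: "(a t)\<^sup>2 + (b t)\<^sup>2 = r\<^sup>2" for t
    by (simp add: r_def)
  have uu: "u t \<bullet> u t = r\<^sup>2" for t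
    by (simp add: u_def inner_frame[OF one] r2)
  have "r \<ge> 0" by (simp add: r_def)
  have "r \<noteq> 0"
  proof
    assume "r = 0"
    then have "u t = 0" for t using uu[of t] by simp
    then have "(\<gamma> has_vector_derivative 0) (at t)" for t using d\<gamma>'[of t] by simp
    from constant_if_vector_derivative_zero[OF this] nonconst show False
      unfolding constant_on_def by blast
  qed
  with \<open>r \<ge> 0\<close> have "r > 0" by simp
  have du: "(u has_vector_derivative (- 2 * c) *\<^sub>R E3 (u t) - r\<^sup>2 *\<^sub>R \<gamma> t) (at t)" for t
  proof -
    have "(u has_vector_derivative
        (a t *\<^sub>R E1 (u t) + (2 * c * b t) *\<^sub>R E1 (\<gamma> t)) +
        (b t *\<^sub>R E2 (u t) + (- 2 * c * a t) *\<^sub>R E2 (\<gamma> t))) (at t)"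
      unfolding u_def[abs_def]
      by (intro has_vector_derivative_add has_vector_derivative_scaleR da db
          E_has_vector_derivative d\<gamma>)
    \<comment> \<open>The mixed \<open>E3\<close> terms of \<open>a E1 u + b E2 u\<close> cancel,
      leaving \<open>- (a^2 + b^2) \<gamma>\<close>; the remaining two terms form
      \<open>- 2 c E3 u\<close>.\<close>
    moreover have "(a t *\<^sub>R E1 (u t) + (2 * c * b t) *\<^sub>R E1 (\<gamma> t)) +
        (b t *\<^sub>R E2 (u t) + (- 2 * c * a t) *\<^sub>R E2 (\<gamma> t)) =
        (- 2 * c) *\<^sub>R E3 (u t) - r\<^sup>2 *\<^sub>R \<gamma> t"
      unfolding r2[of t, symmetric]
      by (simp add: u_def E_linear_simps quaternion_relations power2_eq_square algebra_simps)
    ultimately show ?thesis by simp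
  qed

  \<comment> \<open>\<open>\<alpha>\<close> and \<open>- \<beta>\<close> are the two roots
    \<open>- c + \<rho>\<close> and \<open>- c - \<rho>\<close> of
    \<open>\<omega>^2 + 2 c \<omega> - r^2 = 0\<close>.\<close>
  define \<rho> where "\<rho> = sqrt (r\<^sup>2 + c\<^sup>2)"
  define \<alpha> \<beta> where "\<alpha> = \<rho> - c" and "\<beta> = \<rho> + c"
  have "\<bar>c\<bar> < \<rho>"
    unfolding \<rho>_def using \<open>r > 0\<close> by (intro real_less_rsqrt) simp
  then have pos: "\<alpha> > 0" "\<beta> > 0" by (auto simp: \<alpha>_def \<beta>_def)
  have "\<rho>\<^sup>2 = r\<^sup>2 + c\<^sup>2" by (simp add: \<rho>_def)
  then have prod: "\<alpha> * \<beta> = r\<^sup>2"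
    by (simp add: \<alpha>_def \<beta>_def algebra_simps power2_eq_square)
  have diff: "\<alpha> - \<beta> = - 2 * c" by (simp add: \<alpha>_def \<beta>_def)

  \<comment> \<open>With D = d/dt and i = \<open>E3\<close>, the conditions on
    \<open>\<omega>\<close> and \<open>\<mu>\<close> say that D^2 + 2 c i D + r^2 factors as (D -
    \<omega> i)(D + \<mu> i). The pairs used are \<open>(\<alpha>, \<beta>)\<close> and
    \<open>(- \<beta>, - \<alpha>)\<close>.\<close>
  have rot: "((\<lambda>t. u t + \<mu> *\<^sub>R E3 (\<gamma> t)) has_vector_derivative \<omega> *\<^sub>R E3 (u t + \<mu> *\<^sub>R E3 (\<gamma> t))) (at t)"
    if "\<omega> * \<mu> = r\<^sup>2" "\<omega> - \<mu> = - 2 * c" for \<omega> \<mu> t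
  proof -
    have "((\<lambda>t. u t + \<mu> *\<^sub>R E3 (\<gamma> t)) has_vector_derivative
        ((- 2 * c) *\<^sub>R E3 (u t) - r\<^sup>2 *\<^sub>R \<gamma> t) + \<mu> *\<^sub>R E3 (u t)) (at t)"
      by (intro has_vector_derivative_add du bounded_linear.has_vector_derivative[OF
            bounded_linear_scaleR_right] E_has_vector_derivative d\<gamma>')
    then show ?thesis
      unfolding that[symmetric]
      by (simp add: E_linear_simps quaternion_relations algebra_simps)
  qed
  \<comment> \<open>The velocity is nonzero and orthogonal to \<open>E3 \<gamma>\<close>, so no
    multiple of \<open>E3 \<gamma>\<close> can cancel it.\<close>
  have nz: "u t + \<mu> *\<^sub>R E3 (\<gamma> t) \<noteq> 0" for \<mu> t
  proof
    assume "u t + \<mu> *\<^sub>R E3 (\<gamma> t) = 0"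
    then have "u t \<bullet> (u t + \<mu> *\<^sub>R E3 (\<gamma> t)) = 0" by simp
    moreover have "u t \<bullet> E3 (\<gamma> t) = 0" by (simp add: u_def inner_add_left)
    ultimately show False using uu[of t] \<open>r > 0\<close> by (simp add: inner_add_right)
  qed

  have period: "\<exists>(k::int) (l::int). \<alpha> * T = 2 * pi * k \<and> \<beta> * T = 2 * pi * l"
    if T: "\<forall>t. \<gamma> (t + T) = \<gamma> t" for T
  proof -
    \<comment> \<open>Periodicity passes from \<open>\<gamma>\<close> to its velocity, hence to both
      modes.\<close>
    have "((\<lambda>t. t + T) has_vector_derivative 1) (at 0)"
      by (auto intro!: derivative_eq_intros)
    from vector_diff_chain_at[OF this, of \<gamma> "u T"] d\<gamma>'[of T]
    have "((\<lambda>t. \<gamma> (t + T)) has_vector_derivative u T) (at 0)"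
      by (simp add: o_def)
    then have "u T = u 0"
      using T d\<gamma>'[of 0] vector_derivative_unique_at by auto
    moreover have "\<gamma> T = \<gamma> 0" using T by (metis add_0)
    ultimately have T': "u T + \<mu> *\<^sub>R E3 (\<gamma> T) = u 0 + \<mu> *\<^sub>R E3 (\<gamma> 0)" for \<mu> by simp
    have "cos (\<alpha> * T) = 1"
      using rotating_periodic_imp_cos_eq_1[OF rot T' nz, of \<alpha> \<beta>] prod diff by simp
    moreover have "cos (- \<beta> * T) = 1"
      using rotating_periodic_imp_cos_eq_1[OF rot T' nz, of "- \<beta>" "- \<alpha>"] prod diff
      by (simp add: mult.commute)
    ultimately show ?thesis
      by (auto simp: cos_one_2pi_int mult_ac)
  qed

  text \<open>The least period exists because \<open>\<alpha> T / (2 \<pi>)\<close> is a positive integer for every period \<open>T\<close>.\<close>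
  let ?P = "\<lambda>T. 0 < T \<and> (\<forall>t. \<gamma> (t + T) = \<gamma> t)"
  define T where "T = (LEAST T. ?P T)"
  have "?P T"
  proof -
    define N where "N k \<longleftrightarrow> (\<exists>T. ?P T \<and> \<alpha> * T = 2 * pi * real k)" for k
    have N: "\<exists>k. N k \<and> \<alpha> * T = 2 * pi * real k" if T: "?P T" for T
    proof -
      obtain k :: int where k: "\<alpha> * T = 2 * pi * k" using period T by blast
      then have "2 * pi * k > 0" using T pos by (metis mult_pos_pos)
      then have "k > 0" by (simp add: zero_less_mult_iff)
      then have "\<alpha> * T = 2 * pi * real (nat k)" using k by simp
      with T show ?thesis unfolding N_def by blast
    qed
    then have "\<exists>k. N k" using closed by blast
    then have "N (LEAST k. N k)" by (rule LeastI_ex)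
    then obtain T0 where T0: "?P T0" "\<alpha> * T0 = 2 * pi * real (LEAST k. N k)"
      unfolding N_def[of "Least N"] by blast
    have "T0 \<le> S" if S: "?P S" for S
    proof -
      obtain k where k: "N k" "\<alpha> * S = 2 * pi * real k" using N[OF S] by blast
      then have "\<alpha> * T0 \<le> \<alpha> * S" using T0 Least_le[of N k] by simp
      then show ?thesis using pos by simp
    qed
    then have "T = T0" unfolding T_def using T0(1) by (intro Least_equality)
    with T0 show ?thesis by simp
  qed
  then obtain k l :: int where kl: "\<alpha> * T = 2 * pi * k" "\<beta> * T = 2 * pi * l" and "T > 0"
    using period by blast
  then have "2 * pi * k > 0" "2 * pi * l > 0" using pos by (metis mult_pos_pos)+
  then have "k > 0" "l > 0" by (simp_all add: zero_less_mult_iff)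
  have "(r * T)\<^sup>2 = (\<alpha> * T) * (\<beta> * T)"
    using prod by (simp add: power2_eq_square)
  also have "\<dots> = (2 * pi)\<^sup>2 * real (nat (k * l))"
    using \<open>k > 0\<close> \<open>l > 0\<close> by (simp add: kl power2_eq_square)
  finally have "r * T = 2 * pi * sqrt (real (nat (k * l)))"
    using \<open>r > 0\<close> \<open>T > 0\<close>
    by (metis abs_of_pos mult_pos_pos pi_gt_zero real_sqrt_abs real_sqrt_mult zero_less_numeral)
  moreover have "closed_geodesic_length \<gamma> = r * T"
  proof -
    have "norm (vector_derivative \<gamma> (at t)) = r" for t
      using vector_derivative_at[OF d\<gamma>'[of t]] uu[of t] \<open>r > 0\<close> by (simp add: norm_eq_sqrt_inner)
    then show ?thesis
      using \<open>T > 0\<close> by (simp add: closed_geodesic_length_def T_def[symmetric] sr_length_def)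
  qed
  moreover have "nat (k * l) \<ge> 1"
    using \<open>k > 0\<close> \<open>l > 0\<close> by (simp add: Suc_le_eq)
  ultimately show thesis using that by simp
qed

section \<open>From the frame equations back to geodesics\<close>

text \<open>The covector with values \<open>a\<close>, \<open>b\<close>, \<open>c\<close> on the
  frame and 0 on the normal is a lift of \<open>q\<close>. It solves Hamilton's equations in the
  ambient cotangent bundle of R^4, hence against every vector tangent to
  \<open>cotangent_S3\<close>.\<close>

lemma sr_geodesic_if_frame_equations:
  assumes one: "\<And>t. q t \<bullet> q t = 1"
    and dq: "\<And>t. (q has_vector_derivative a t *\<^sub>R E1 (q t) + b t *\<^sub>R E2 (q t)) (at t)"
    and da: "\<And>t. (a has_real_derivative 2 * c * b t) (at t)"
    and db: "\<And>t. (b has_real_derivative - 2 * c * a t) (at t)"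
  shows "sr_geodesic q"
proof -
  define p where "p t = a t *\<^sub>R E1 (q t) + b t *\<^sub>R E2 (q t) + c *\<^sub>R E3 (q t)" for t
  define u where "u t = a t *\<^sub>R E1 (q t) + b t *\<^sub>R E2 (q t)" for t
  \<comment> \<open>Because \<open>E1\<close> and \<open>E2\<close> are skew, Hamilton's equation
    for \<open>p\<close> is the same linear equation as the one for \<open>q\<close>.\<close>
  define p' where "p' t = a t *\<^sub>R E1 (p t) + b t *\<^sub>R E2 (p t)" for t
  have dp: "(p has_vector_derivative p' t) (at t)" for t
  proof -
    have "(p has_vector_derivative
        (a t *\<^sub>R E1 (u t) + (2 * c * b t) *\<^sub>R E1 (q t)) +
        (b t *\<^sub>R E2 (u t) + (- 2 * c * a t) *\<^sub>R E2 (q t)) + c *\<^sub>R E3 (u t)) (at t)"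
      unfolding p_def[abs_def]
      by (intro has_vector_derivative_add has_vector_derivative_scaleR da db
          bounded_linear.has_vector_derivative[OF bounded_linear_scaleR_right]
          E_has_vector_derivative dq[folded u_def])
    moreover have "(a t *\<^sub>R E1 (u t) + (2 * c * b t) *\<^sub>R E1 (q t)) +
        (b t *\<^sub>R E2 (u t) + (- 2 * c * a t) *\<^sub>R E2 (q t)) + c *\<^sub>R E3 (u t) = p' t"
      by (simp add: u_def p_def p'_def vec_eq_iff forall_4 algebra_simps)
    ultimately show ?thesis by simp
  qed
  let ?z = "\<lambda>t. (q t, blinfun_inner_left (p t))"
  have "hamilton_solution ?z"
    unfolding hamilton_solution_def
  proof (intro conjI allI)
    show "?z t \<in> cotangent_S3" for t
      using one[of t] by (simp add: cotangent_S3_def S3_iff_inner p_def inner_add_left inner_add_right)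
    have pE: "E1 (q t) \<bullet> p t = a t" "E2 (q t) \<bullet> p t = b t" for t
      using one[of t] by (simp_all add: p_def inner_add_right)
    show "\<exists>Z. (?z has_vector_derivative Z) (at t) \<and> (\<forall>Y \<in> tangent_space cotangent_S3 (?z t).
        symplectic_form (?z t) Z Y = frechet_derivative hamiltonian (at (?z t)) Y)" for t
    proof (intro exI conjI ballI)
      show "(?z has_vector_derivative (u t, blinfun_inner_left (p' t))) (at t)"
        by (intro has_vector_derivative_Pair dq[folded u_def] dp
            bounded_linear.has_vector_derivative[OF bounded_linear_blinfun_inner_left])
      show "symplectic_form (?z t) (u t, blinfun_inner_left (p' t)) Y =
          frechet_derivative hamiltonian (at (?z t)) Y" for Y
      proof (cases Y)
        case (Pair v \<beta>)
        show ?thesis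
          by (simp add: Pair symplectic_form_eq hamiltonian_derivative pE u_def p'_def
              blinfun.bilinear_simps inner_add_right E_skew[of v] algebra_simps)
      qed
    qed
  qed
  then show ?thesis
    unfolding sr_geodesic_def by (intro exI[of _ ?z]) (simp add: fun_eq_iff)
qed

section \<open>Explicit closed geodesics of every admissible length\<close>

text \<open>In complex notation the closed geodesic of length \<open>2\<pi>\<surd>n\<close> is
  \<open>z\<^sub>1 = (e\<^bsup>int\<^esup> + n e\<^bsup>-it\<^esup>) / (n + 1)\<close>, \<open>z\<^sub>2 = \<surd>n (e\<^bsup>int\<^esup> - e\<^bsup>-it\<^esup>) / (i (n + 1))\<close>.\<close>

definition model_geodesic :: "nat \<Rightarrow> real \<Rightarrow> real^4" where
  "model_geodesic n t = (1 / (real n + 1)) *\<^sub>R vector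
     [cos (n * t) + n * cos t, sin (n * t) - n * sin t,
      sqrt n * (sin (n * t) + sin t), - sqrt n * (cos (n * t) - cos t)]"

lemma model_geodesic_nth [simp]:
  "model_geodesic n t $ 1 = (cos (n * t) + n * cos t) / (real n + 1)"
  "model_geodesic n t $ 2 = (sin (n * t) - n * sin t) / (real n + 1)"
  "model_geodesic n t $ 3 = sqrt n * (sin (n * t) + sin t) / (real n + 1)"
  "model_geodesic n t $ 4 = - sqrt n * (cos (n * t) - cos t) / (real n + 1)"
  by (simp_all add: model_geodesic_def vector_def)

lemma model_geodesic_S3: "model_geodesic n t \<bullet> model_geodesic n t = 1"
proof -
  let ?C = "cos (n * t)" and ?S = "sin (n * t)"
  have "(?C + n * cos t)\<^sup>2 + (?S - n * sin t)\<^sup>2 + (sqrt n * (?S + sin t))\<^sup>2 +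
      (sqrt n * (?C - cos t))\<^sup>2 = (real n + 1) * (?C\<^sup>2 + ?S\<^sup>2) + (n * (real n + 1)) * ((cos t)\<^sup>2 + (sin t)\<^sup>2)"
    unfolding power_mult_distrib
    by (simp add: power2_eq_square algebra_simps del: sin_cos_squared_add3)
  also have "\<dots> = (real n + 1)\<^sup>2"
    unfolding sin_cos_squared_add2 by (simp add: power2_eq_square algebra_simps)
  finally show ?thesis
    by (simp add: inner_vec_def sum_4 power2_eq_square add_divide_distrib[symmetric])
qed

text \<open>The coefficient vector has norm \<open>sqrt n\<close>, the speed, and turns at the rate
  \<open>\<alpha> - \<beta> = n - 1\<close>; it starts in the direction of
  \<open>E1\<close>.\<close>

lemma model_geodesic_frame_equation:
  "(model_geodesic n has_vector_derivative
     (sqrt n * cos ((real n - 1) * t)) *\<^sub>R E1 (model_geodesic n t) +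
     (sqrt n * sin ((real n - 1) * t)) *\<^sub>R E2 (model_geodesic n t)) (at t)"
proof -
  let ?C = "cos (n * t)" and ?S = "sin (n * t)" and ?c = "cos t" and ?s = "sin t"
  let ?d = "vector [- n * (?S + ?s), n * (?C - ?c), sqrt n * (n * ?C + ?c), sqrt n * (n * ?S - ?s)] :: real^4"
  \<comment> \<open>The expanded square of \<open>real n + 1\<close>, needed nonzero to clear
    denominators.\<close>
  have nz: "1 + (real n * real n + real n * 2) \<noteq> 0"
    by (metis add_nonneg_nonneg add_pos_nonneg mult_nonneg_nonneg of_nat_0_le_iff order_less_irrefl zero_le_numeral zero_less_one)
  have "((\<lambda>t. model_geodesic n t $ i) has_real_derivative ((1 / (real n + 1)) *\<^sub>R ?d) $ i) (at t)" for i
    using exhaust_4[of i] nz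
    by (auto intro!: derivative_eq_intros simp: vector_def divide_simps algebra_simps)
  then have "(model_geodesic n has_vector_derivative (1 / (real n + 1)) *\<^sub>R ?d) (at t)"
    by (rule has_vector_derivative_vec)
  moreover have "(1 / (real n + 1)) *\<^sub>R ?d =
     (sqrt n * cos ((real n - 1) * t)) *\<^sub>R E1 (model_geodesic n t) +
     (sqrt n * sin ((real n - 1) * t)) *\<^sub>R E2 (model_geodesic n t)"
  proof -
    \<comment> \<open>After the addition formulas each coordinate is a polynomial identity in
      \<open>?C\<close>, \<open>?S\<close>, \<open>?c\<close>, \<open>?s\<close> and
      \<open>sqrt n\<close> modulo these relations.\<close>
    have unit: "?C * ?C + ?S * ?S = 1" "?c * ?c + ?s * ?s = 1"
      by (simp_all flip: power2_eq_square)
    have addition: "cos ((real n - 1) * t) = ?C * ?c + ?S * ?s" "sin ((real n - 1) * t) = ?S * ?c - ?C * ?s"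
      by (simp_all add: left_diff_distrib cos_diff sin_diff)
    have sq: "sqrt n * sqrt n = real n" by simp
    show ?thesis
      unfolding vec_eq_iff forall_4 addition
      by (intro conjI; simp add: vector_def divide_inverse; use unit sq in algebra)
  qed
  ultimately show ?thesis by simp
qed

lemma model_geodesic_closed:
  assumes "n \<ge> 1"
  shows "closed_sr_geodesic (model_geodesic n)"
    "closed_geodesic_length (model_geodesic n) = 2 * pi * sqrt (real n)"
proof -
  let ?g = "model_geodesic n"
  have n: "real n > 0" using assms by simp
  have per: "?g (t + 2 * pi) = ?g t" for t
  proof -
    have "cos (n * (t + 2 * pi)) = cos (n * t)" "sin (n * (t + 2 * pi)) = sin (n * t)"
      using sin.plus_of_nat[of "n * t" n] cos.plus_of_nat[of "n * t" n]
      by (simp_all add: algebra_simps)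
    then show ?thesis by (simp add: vec_eq_iff forall_4)
  qed
  have least: "2 * pi \<le> T" if "T > 0" "\<forall>t. ?g (t + T) = ?g t" for T
  proof -
    have "?g T = ?g 0" using that(2) by (metis add_0)
    \<comment> \<open>The first coordinate attains its maximum at time 0, and attaining it again at
      \<open>T\<close> forces \<open>cos T = 1\<close>.\<close>
    then have "?g T $ 1 = ?g 0 $ 1" by simp
    then have "cos (n * T) + n * cos T = 1 + n" by (simp add: divide_simps split: if_splits)
    moreover have "cos (n * T) \<le> 1" "n * cos T \<le> n" using n by simp_all
    ultimately have "n * cos T = n" by linarith
    then have "cos T = 1" using n by simp
    then obtain k :: int where k: "T = k * 2 * pi" by (auto simp: cos_one_2pi_int)
    with that(1) have "k > 0" by (simp add: zero_less_mult_iff)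
    then have "real_of_int k \<ge> 1" by linarith
    then have "1 * (2 * pi) \<le> k * (2 * pi)" by (intro mult_right_mono) auto
    then show ?thesis using k by simp
  qed
  have geo: "sr_geodesic ?g"
    \<comment> \<open>The value of \<open>c\<close> comes from
      \<open>\<alpha> - \<beta> = - 2 * c\<close> with \<open>\<alpha> = n\<close> and
      \<open>\<beta> = 1\<close>.\<close>
    by (rule sr_geodesic_if_frame_equations[OF model_geodesic_S3
          model_geodesic_frame_equation, where c = "(1 - real n) / 2"])
      (auto intro!: derivative_eq_intros simp: algebra_simps)
  have "\<not> ?g constant_on UNIV"
  proof
    assume "?g constant_on UNIV"
    \<comment> \<open>A constant curve would have the period 1, below the least period
      \<open>2 * pi\<close>.\<close>
    then have "?g (t + 1) = ?g t" for t by (auto simp: constant_on_def)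
    with least[of 1] pi_gt3 show False by simp
  qed
  with geo per show "closed_sr_geodesic ?g"
    unfolding closed_sr_geodesic_def by (auto intro!: exI[of _ "2 * pi"])
  have "(LEAST T. 0 < T \<and> (\<forall>t. ?g (t + T) = ?g t)) = 2 * pi"
    using per least by (intro Least_equality) auto
  moreover have "norm (vector_derivative ?g (at t)) = sqrt n" for t
  proof -
    let ?x = "(real n - 1) * t"
    have "(norm (vector_derivative ?g (at t)))\<^sup>2 = n * ((cos ?x)\<^sup>2 + (sin ?x)\<^sup>2)"
      unfolding vector_derivative_at[OF model_geodesic_frame_equation] power2_norm_eq_inner
        inner_frame[OF model_geodesic_S3]
      by (simp add: power_mult_distrib flip: distrib_left)
    then show ?thesis by (simp add: real_sqrt_unique)
  qed
  ultimately show "closed_geodesic_length ?g = 2 * pi * sqrt (real n)"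
    by (simp add: closed_geodesic_length_def sr_length_def)
qed

theorem mainTheorem1:
  shows "{closed_geodesic_length \<gamma> | \<gamma>. closed_sr_geodesic \<gamma>}
       = {2 * pi * sqrt (real n) | n :: nat. n \<ge> 1}"
proof (intro equalityI subsetI)
  fix x assume "x \<in> {closed_geodesic_length \<gamma> | \<gamma>. closed_sr_geodesic \<gamma>}"
  then show "x \<in> {2 * pi * sqrt (real n) | n :: nat. n \<ge> 1}"
    by (auto elim: closed_sr_geodesic_length_cases)
next
  fix x assume "x \<in> {2 * pi * sqrt (real n) | n :: nat. n \<ge> 1}"
  then obtain n :: nat where "n \<ge> 1" "x = 2 * pi * sqrt (real n)" by blast
  with model_geodesic_closed[of n] show "x \<in> {closed_geodesic_length \<gamma> | \<gamma>. closed_sr_geodesic \<gamma>}"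
    by force
qed

end
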